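(* Let $n\geq 3$. The nilpotent factor $N$ in the Iwasawa decomposition $SO^0(2,n)=KAN$ acts with cohomogeneity one on $AdS^{n+1}$. For every $p\in AdS^{n+1}$ with $p_2\neq p_4$, the orbit $N\cdot p$ is principal and is obtained as the intersection of $AdS^{n+1}$ with the affine hyperplane $p+\mathbb{W}$, where $\mathbb{W}=\{x\in\mathbb{R}^{2,n}:x_2=x_4\}$. If $p_2=p_4$, then $N\cdot p$ is a singular orbit of dimension $n-1$ that is obtained by intersecting $AdS^{n+1}$ with the affine subspace $p+\mathbb{V}$, where $\mathbb{V}=\{x\in\mathbb{R}^{2,n}:x_1=x_3,\ x_2=x_4\}$. In particular, principal orbits are parametrized by the non-zero values of $p_2-p_4$, and singular orbits (where $p_2=p_4$) are parametrized by the non-zero values of $p_1-p_3$.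
   Context: $\mathbb{R}^{2,n}$ is $\mathbb{R}^{n+2}$ with coordinates $x_1,\dots,x_{n+2}$ and scalar product $\langle x,y\rangle=-x_1y_1-x_2y_2+x_3y_3+\dots+x_{n+2}y_{n+2}$; $AdS^{n+1}=\{x\in\mathbb{R}^{2,n}:\langle x,x\rangle=-1\}$. $SO^0(2,n)$ is the identity component of the group of determinant 1 linear isometries of $\mathbb{R}^{2,n}$, acting naturally on $AdS^{n+1}$; its Lie algebra is $\mathfrak{g}=\mathfrak{so}(2,n)$. Let $\mathfrak{k}\cong\mathfrak{so}(2)\oplus\mathfrak{so}(n)$ be the subalgebra of skew-symmetric matrices in $\mathfrak{g}$, and let $\mathfrak{a}=\{H_{a,b}:a,b\in\mathbb{R}\}$, where $H_{a,b}$ is the matrix whose only possibly nonzero entries are $(1,3)$ and $(3,1)$, equal to $a$, and $(2,4)$ and $(4,2)$, equal to $b$. For $\lambda\in\mathfrak{a}^*$ put $\mathfrak{g}_\lambda=\{X\in\mathfrak{g}:[H,X]=\lambda(H)X\ \forall H\in\mathfrak{a}\}$. With $\alpha_1(H_{a,b})=-a+b$ and $\alpha_2(H_{a,b})=a$, the positive roots are $\alpha_1,\alpha_2,\alpha_1+\alpha_2,\alpha_1+2\alpha_2$, and $\mathfrak{n}=\mathfrak{g}_{\alpha_1}\oplus\mathfrak{g}_{\alpha_2}\oplus\mathfrak{g}_{\alpha_1+\alpha_2}\oplus\mathfrak{g}_{\alpha_1+2\alpha_2}$. Explicitly, $\mathfrak{n}$ consists of the matrices (block sizes $1,1,1,1,n-2$)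 $$\begin{pmatrix} 0 & b+a & 0 & -b-a & v^{\top}\\ -b-a & 0 & -b+a & 0 & w^{\top}\\ 0 & -b+a & 0 & b-a & v^{\top}\\ -b-a & 0 & -b+a & 0 & w^{\top}\\ v & w & -v & -w & 0 \end{pmatrix},\qquad a,b\in\mathbb{R},\ v,w\in\mathbb{R}^{n-2}.$$ $K,A,N$ are the connected Lie subgroups of $SO^0(2,n)$ with Lie algebras $\mathfrak{k},\mathfrak{a},\mathfrak{n}$. An isometric action has cohomogeneity $r$ if the minimum codimension of its orbits is $r$. Here an orbit is called principal if it has the maximal dimension among orbits (codimension one) and singular if it has smaller dimension. *)

theory Defs
  imports "HOL-Analysis.Analysis"
begin

text \<open>
  The space $R^{2,n}$ is rendered as \<^typ>\<open>real^(4 + 'm)\<close> with \<open>CARD('m) = n - 2\<close>: the coordinates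
  $x_1,\dots,x_4$ are \<open>x $ Inl 1\<close>, \dots, \<open>x $ Inl 4\<close>, and $x_5,\dots,x_{n+2}$ are \<open>x $ Inr j\<close>.
  In the four-element type \<open>4\<close> the numeral \<open>4\<close> denotes the same element as \<open>0\<close>, so that
  \<open>1, 2, 3, 4\<close> are its four distinct elements.
\<close>

definition ip :: "real^(4 + 'm::finite) \<Rightarrow> real^(4 + 'm) \<Rightarrow> real" where
  "ip x y = - x $ Inl 1 * y $ Inl 1 - x $ Inl 2 * y $ Inl 2
            + x $ Inl 3 * y $ Inl 3 + x $ Inl 4 * y $ Inl 4
            + (\<Sum>j\<in>UNIV. x $ Inr j * y $ Inr j)"

definition AdS :: "(real^(4 + 'm::finite)) set" where
  "AdS = {x. ip x x = - 1}"

definition SO_2n :: "(real^(4 + 'm::finite)^(4 + 'm)) set" where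
  "SO_2n = {g. det g = 1 \<and> (\<forall>x y. ip (g *v x) (g *v y) = ip x y)}"

definition SO0_2n :: "(real^(4 + 'm::finite)^(4 + 'm)) set" where
  "SO0_2n = connected_component_set SO_2n (mat 1)"


definition mexp :: "real^'k^'k \<Rightarrow> real^'k^'k::finite" where
  "mexp X = (\<Sum>j. (1 / fact j) *\<^sub>R (((**) X ^^ j) (mat 1)))"

definition lie_bracket :: "real^'k^'k \<Rightarrow> real^'k^'k \<Rightarrow> real^'k^'k::finite" where
  "lie_bracket X Y = X ** Y - Y ** X"

definition Lie_algebra :: "(real^'k^'k::finite) set \<Rightarrow> (real^'k^'k) set" where
  "Lie_algebra G = {X. \<forall>t::real. mexp (t *\<^sub>R X) \<in> G}"

definition Lie_subalgebra :: "(real^'k^'k::finite) set \<Rightarrow> (real^'k^'k) set \<Rightarrow> bool" where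
  "Lie_subalgebra \<hh> \<gg> \<longleftrightarrow> subspace \<hh> \<and> \<hh> \<subseteq> \<gg> \<and> (\<forall>X\<in>\<hh>. \<forall>Y\<in>\<hh>. lie_bracket X Y \<in> \<hh>)"

definition matrix_group :: "(real^'k^'k::finite) set \<Rightarrow> bool" where
  "matrix_group G \<longleftrightarrow> mat 1 \<in> G \<and> (\<forall>g\<in>G. \<forall>h\<in>G. g ** h \<in> G)
                      \<and> (\<forall>g\<in>G. invertible g \<and> matrix_inv g \<in> G)"

text \<open>
  A connected Lie subgroup of a matrix group, not required to be closed, as in B. C. Hall,
  \<^emph>\<open>Lie Groups, Lie Algebras, and Representations\<close>, 2nd ed., Def. 5.19: connectedness
  is expressed by requiring that the group is generated by the exponentials of its Lie algebra.
  By the Lie subgroup theorem, for every Lie subalgebra of the ambient Lie algebra there is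
  exactly one such subgroup with that Lie algebra.
\<close>

definition connected_Lie_subgroup :: "(real^'k^'k::finite) set \<Rightarrow> (real^'k^'k) set \<Rightarrow> bool" where
  "connected_Lie_subgroup H G \<longleftrightarrow>
     matrix_group H \<and> H \<subseteq> G \<and> Lie_subalgebra (Lie_algebra H) (Lie_algebra G) \<and>
     (\<forall>h\<in>H. \<exists>Xs. set Xs \<subseteq> Lie_algebra H \<and> h = foldr (\<lambda>X g. mexp X ** g) Xs (mat 1))"


definition so_2n :: "(real^(4 + 'm::finite)^(4 + 'm)) set" where
  "so_2n = Lie_algebra SO0_2n"

definition H_mat :: "real \<Rightarrow> real \<Rightarrow> real^(4 + 'm::finite)^(4 + 'm)" where
  "H_mat a b = (\<chi> i j. if (i, j) \<in> {(Inl 1, Inl 3), (Inl 3, Inl 1)} then a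
                      else if (i, j) \<in> {(Inl 2, Inl 4), (Inl 4, Inl 2)} then b
                      else 0)"

definition \<aa>_alg :: "(real^(4 + 'm::finite)^(4 + 'm)) set" where
  "\<aa>_alg = {H_mat a b | a b. True}"

definition root_space ::
  "(real^(4 + 'm::finite)^(4 + 'm) \<Rightarrow> real) \<Rightarrow> (real^(4 + 'm)^(4 + 'm)) set" where
  "root_space \<mu> = {X \<in> so_2n. \<forall>H\<in>\<aa>_alg. lie_bracket H X = \<mu> H *\<^sub>R X}"

text \<open>
  The simple roots, as linear functionals: on \<open>H_mat a b\<close> the entry \<open>(1,3)\<close> is \<open>a\<close> and the
  entry \<open>(2,4)\<close> is \<open>b\<close>.
\<close>

definition \<alpha>\<^sub>1 :: "real^(4 + 'm::finite)^(4 + 'm) \<Rightarrow> real" where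
  "\<alpha>\<^sub>1 H = - (H $ Inl 1 $ Inl 3) + H $ Inl 2 $ Inl 4"

definition \<alpha>\<^sub>2 :: "real^(4 + 'm::finite)^(4 + 'm) \<Rightarrow> real" where
  "\<alpha>\<^sub>2 H = H $ Inl 1 $ Inl 3"

definition \<nn>_alg :: "(real^(4 + 'm::finite)^(4 + 'm)) set" where
  "\<nn>_alg = {X1 + X2 + X3 + X4 | X1 X2 X3 X4.
              X1 \<in> root_space \<alpha>\<^sub>1 \<and>
              X2 \<in> root_space \<alpha>\<^sub>2 \<and>
              X3 \<in> root_space (\<lambda>H. \<alpha>\<^sub>1 H + \<alpha>\<^sub>2 H) \<and>
              X4 \<in> root_space (\<lambda>H. \<alpha>\<^sub>1 H + 2 * \<alpha>\<^sub>2 H)}"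


definition tangent_space :: "'a::euclidean_space set \<Rightarrow> 'a \<Rightarrow> 'a set" where
  "tangent_space S p = {v. \<exists>\<epsilon>>0. \<exists>c c'. c 0 = p \<and> c' 0 = v \<and>
       (\<forall>t\<in>{-\<epsilon><..<\<epsilon>}. c t \<in> S \<and> (c has_vector_derivative c' t) (at t)) \<and>
       continuous_on {-\<epsilon><..<\<epsilon>::real} c'}"

text \<open>
  The dimension of a (possibly only immersed) submanifold of a Euclidean space, namely
  the common dimension of its tangent spaces.
\<close>

definition mfd_dim :: "'a::euclidean_space set \<Rightarrow> nat" where
  "mfd_dim S = (THE d. \<forall>x\<in>S. dim (tangent_space S x) = d)"

definition codim_in :: "'a::euclidean_space set \<Rightarrow> 'a set \<Rightarrow> int" where
  "codim_in M S = int (mfd_dim M) - int (mfd_dim S)"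

definition orbit :: "(real^'k^'k) set \<Rightarrow> real^'k::finite \<Rightarrow> (real^'k) set" where
  "orbit G p = {g *v p | g. g \<in> G}"

definition orbits :: "(real^'k^'k) set \<Rightarrow> (real^'k::finite) set \<Rightarrow> (real^'k) set set" where
  "orbits G M = orbit G ` M"

definition acts_isometrically ::
  "(real^(4 + 'm::finite)^(4 + 'm)) set \<Rightarrow> (real^(4 + 'm)) set \<Rightarrow> bool" where
  "acts_isometrically G M \<longleftrightarrow> matrix_group G \<and>
     (\<forall>g\<in>G. (\<forall>x y. ip (g *v x) (g *v y) = ip x y) \<and> (\<forall>x\<in>M. g *v x \<in> M))"

definition cohomogeneity :: "(real^'k^'k) set \<Rightarrow> (real^'k::finite) set \<Rightarrow> int" where
  "cohomogeneity G M = Min (codim_in M ` orbits G M)"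

definition principal_orbit ::
  "(real^'k^'k) set \<Rightarrow> (real^'k::finite) set \<Rightarrow> (real^'k) set \<Rightarrow> bool" where
  "principal_orbit G M B \<longleftrightarrow> B \<in> orbits G M \<and> (\<forall>B'\<in>orbits G M. mfd_dim B' \<le> mfd_dim B)"

definition singular_orbit ::
  "(real^'k^'k) set \<Rightarrow> (real^'k::finite) set \<Rightarrow> (real^'k) set \<Rightarrow> bool" where
  "singular_orbit G M B \<longleftrightarrow> B \<in> orbits G M \<and> (\<exists>B'\<in>orbits G M. mfd_dim B < mfd_dim B')"


definition \<W> :: "(real^(4 + 'm::finite)) set" where
  "\<W> = {x. x $ Inl 2 = x $ Inl 4}"

definition \<V> :: "(real^(4 + 'm::finite)) set" where
  "\<V> = {x. x $ Inl 1 = x $ Inl 3 \<and> x $ Inl 2 = x $ Inl 4}"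

end

theory Submission
  imports Defs
begin

text \<open>
  Everything is read off from three weight vectors of \<open>\<aa>_alg\<close> in the ambient space: the null vectors
  \<open>u\<^sub>a = e\<^sub>1 + e\<^sub>3\<close> and \<open>u\<^sub>b = e\<^sub>2 + e\<^sub>4\<close>, of weights \<open>a\<close> and \<open>b\<close>, and \<open>u\<^sub>a\<^sub>' = e\<^sub>1 - e\<^sub>3\<close>, of weight \<open>- a\<close>.

  Since all positive roots are positive at \<open>H_mat 1 2\<close>, an element of \<open>\<nn>_alg\<close> raises the eigenvalues of
  that matrix. Hence it maps the whole space into \<open>\<W>\<close> and \<open>\<W>\<close> into \<open>\<V>\<close> (\<open>\<nn>_raises\<close>). Exponentiating
  and multiplying, elements of \<open>N\<close> move every point by a vector of \<open>\<W>\<close>, and points of \<open>\<W>\<close> by a vector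
  of \<open>\<V>\<close> (\<open>N_displacement\<close>). So the orbit of \<open>p\<close> is contained in the slice of the quadric by
  \<open>p + \<W>\<close>, respectively by \<open>p + \<V>\<close> when \<open>p \<in> \<W>\<close>.

  Conversely, let \<open>u\<close> be null and \<open>z\<close> orthogonal to \<open>u\<close>. The rank-two endomorphism \<open>biv u z\<close> has
  cube zero, so its exponential is an explicit quadratic isometry, a null rotation. If \<open>p\<close> and \<open>x\<close> lie
  on the quadric, \<open>x - p\<close> is orthogonal to \<open>u\<close> and \<open>p\<close> is not, then the null rotation about \<open>u\<close> in the
  direction \<open>x - p\<close>, suitably scaled, carries \<open>p\<close> to \<open>x\<close> (\<open>mexp_biv_transvection\<close>). Weights add up in
  bivectors, whence \<open>biv u\<^sub>b z\<close> is in \<open>\<nn>_alg\<close> for \<open>z \<in> \<W>\<close>, and \<open>biv u\<^sub>a z\<close> is for \<open>z \<in> \<V>\<close>. The vector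
  \<open>u = u\<^sub>b\<close> therefore gives transitivity on the slices with \<open>p\<^sub>2 \<noteq> p\<^sub>4\<close>. If \<open>p\<^sub>2 = p\<^sub>4\<close>, then \<open>p\<^sub>1 \<noteq> p\<^sub>3\<close>,
  because \<open>ip p p\<close> is negative, and \<open>u = u\<^sub>a\<close> does the same.

  The two kinds of orbits and the quadric itself are all slices by an affine subspace \<open>p + L\<close> whose
  direction \<open>L\<close> contains a null vector not orthogonal to the given point. At such a point the slice
  is smooth with tangent space \<open>{v \<in> L. ip p v = 0}\<close> (\<open>tangent_space_AdS_slice\<close>), of dimension one less
  than \<open>L\<close>. With \<open>L\<close> the whole space, \<open>\<W>\<close> and \<open>\<V>\<close> this gives the dimensions \<open>n + 1\<close>, \<open>n\<close> and \<open>n - 1\<close>.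
\<close>

section \<open>The scalar product and its isometries\<close>

lemma sum_coordinates:
  fixes f :: "4 + 'm::finite \<Rightarrow> real"
  shows "(\<Sum>i\<in>UNIV. f i) = f (Inl 1) + f (Inl 2) + f (Inl 3) + f (Inl 4) + (\<Sum>j\<in>UNIV. f (Inr j))"
proof -
  have "(\<Sum>i\<in>UNIV. f i) = (\<Sum>i\<in>UNIV. f (Inl i)) + (\<Sum>j\<in>UNIV. f (Inr j))"
    by (simp add: sum.Plus flip: UNIV_Plus_UNIV)
  then show ?thesis by (simp add: sum_4)
qed

lemma all_coordinates:
  "(\<forall>i::4 + 'm. P i) \<longleftrightarrow> P (Inl 1) \<and> P (Inl 2) \<and> P (Inl 3) \<and> P (Inl 4) \<and> (\<forall>j. P (Inr j))"
  by (metis exhaust_4 sum.exhaust)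

lemma bilinear_ip: "bilinear (ip :: real^(4 + 'm::finite) \<Rightarrow> _)"
  unfolding bilinear_def
  by (auto intro!: linearI
      simp: ip_def algebra_simps sum.distrib sum_distrib_left)

interpretation ip: bounded_bilinear ip
  using bilinear_ip by (simp add: bilinear_conv_bounded_bilinear)

lemmas ip_linear = ip.add_left ip.add_right ip.diff_left ip.diff_right ip.scaleR_left ip.scaleR_right
  ip.minus_left ip.minus_right ip.zero_left ip.zero_right

lemma ip_commute: "ip x y = ip y x"
  by (simp add: ip_def mult.commute)

text \<open>
  The Gram matrix \<open>J\<close> of the scalar product satisfies \<open>J\<^sup>2 = 1\<close>, so it has non-zero determinant, and an
  isometry \<open>g\<close> satisfies \<open>g\<^sup>T J g = J\<close>.
\<close>

lemma sq_det_isometry: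
  fixes g :: "real^(4 + 'm::finite)^(4 + 'm)"
  assumes "\<And>x y. ip (g *v x) (g *v y) = ip x y"
  shows "det g * det g = 1"
proof -
  define \<eta> :: "real^(4 + 'm) \<Rightarrow> real^(4 + 'm)" where
    "\<eta> x = (\<chi> i. if i = Inl 1 \<or> i = Inl 2 then - x $ i else x $ i)" for x
  have lin: "linear \<eta>"
    by (auto intro!: linearI simp: \<eta>_def vec_eq_iff)
  have ip_\<eta>: "ip x y = x \<bullet> \<eta> y" for x y :: "real^(4 + 'm)"
    by (simp add: ip_def \<eta>_def inner_vec_def sum_coordinates)
  define J where "J = matrix \<eta>"
  have J: "J *v x = \<eta> x" for x
    by (simp add: J_def lin)
  have "J ** J = mat 1"
    by (simp add: matrix_eq J \<eta>_def vec_eq_iff flip: matrix_vector_mul_assoc)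
  then have "det J * det J = 1"
    by (metis det_I det_mul)
  moreover have "transpose g ** J ** g = J"
  proof -
    have "x \<bullet> ((transpose g ** J ** g) *v y) = x \<bullet> (J *v y)" for x y
    proof -
      have "x \<bullet> ((transpose g ** J ** g) *v y) = x \<bullet> (transpose g *v (J *v (g *v y)))"
        by (simp flip: matrix_vector_mul_assoc)
      also have "\<dots> = (g *v x) \<bullet> \<eta> (g *v y)"
        by (simp only: J dot_lmul_matrix[symmetric] vector_transpose_matrix)
      also have "\<dots> = x \<bullet> \<eta> y"
        using assms by (simp flip: ip_\<eta>)
      finally show ?thesis by (simp add: J)
    qed
    then show ?thesis
      by (metis matrix_eq vector_eq_ldot)
  qed
  then have "det g * det J * det g = det J"
    by (metis det_mul det_transpose)
  ultimately show ?thesis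
    by (metis (no_types, lifting) mult.assoc mult.commute mult.right_neutral)
qed

section \<open>The matrix exponential\<close>

lemma bounded_bilinear_matrix_mult:
  "bounded_bilinear ((**) :: real^'k^'k::finite \<Rightarrow> real^'k^'k \<Rightarrow> real^'k^'k)"
  unfolding bilinear_conv_bounded_bilinear[symmetric] bilinear_def
  by (intro conjI allI linearI)
    (simp_all add: vec_eq_iff matrix_matrix_mult_def sum.distrib distrib_left distrib_right
      sum_distrib_left mult.assoc mult.left_commute)

lemma mexp_sums:
  fixes X :: "real^'k^'k::finite"
  shows "(\<lambda>j. (1 / fact j) *\<^sub>R (((**) X ^^ j) (mat 1))) sums mexp X"
proof -
  obtain K where K: "K > 0" "\<forall>(A :: real^'k^'k) (B :: real^'k^'k). norm (A ** B) \<le> norm A * norm B * K"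
    using bounded_bilinear.pos_bounded[OF bounded_bilinear_matrix_mult] by auto
  define c where "c = norm (mat 1 :: real^'k^'k)"
  have *: "norm (((**) X ^^ j) (mat 1)) \<le> c * (K * norm X) ^ j" for j
  proof (induction j)
    case (Suc j)
    have "norm (((**) X ^^ Suc j) (mat 1)) \<le> norm X * norm (((**) X ^^ j) (mat 1)) * K"
      using K(2) by simp
    also have "\<dots> \<le> norm X * (c * (K * norm X) ^ j) * K"
      using Suc K(1) by (intro mult_right_mono mult_left_mono) auto
    finally show ?case by (simp add: algebra_simps)
  qed (simp add: c_def)
  have "summable (\<lambda>j. c * (inverse (fact j) * (K * norm X) ^ j))"
    by (intro summable_mult summable_exp)
  then have "summable (\<lambda>j. (1 / fact j) *\<^sub>R (((**) X ^^ j) (mat 1)))"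
    by (rule summable_comparison_test') (use * in \<open>auto simp: field_simps\<close>)
  then show ?thesis
    unfolding mexp_def by (rule summable_sums)
qed

text \<open>
  All terms of the exponential series after the first are vectors in \<open>S\<close> when applied to \<open>x\<close>, and
  subspaces are closed. With \<open>T\<close> the whole space this says that the exponential acts trivially
  modulo \<open>S\<close>; the version with a proper subspace \<open>T\<close> handles one further step of a flag.
\<close>

lemma mexp_displacement:
  fixes X :: "real^'k^'k::finite"
  assumes S: "subspace S" "S \<subseteq> T" and X: "\<And>y. y \<in> T \<Longrightarrow> X *v y \<in> S" and x: "x \<in> T"
  shows "mexp X *v x - x \<in> S"
proof -
  let ?a = "\<lambda>j. (1 / fact j) *\<^sub>R (((**) X ^^ j) (mat 1))"
  have iter: "((**) X ^^ Suc j) (mat 1) *v x \<in> S" for j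
  proof (induction j)
    case 0
    then show ?case using X[OF x] by simp
  next
    case (Suc j)
    have "X *v (((**) X ^^ Suc j) (mat 1) *v x) \<in> S"
      using Suc S(2) by (intro X) auto
    then show ?case
      by (simp add: matrix_vector_mul_assoc)
  qed
  have "(\<lambda>j. ?a j *v x) sums (mexp X *v x)"
  proof (rule bounded_linear.sums[OF _ mexp_sums])
    show "bounded_linear (\<lambda>M :: real^'k^'k. M *v x)"
      by (auto intro!: linearI linear_conv_bounded_linear[THEN iffD1]
          simp: matrix_vector_mult_add_rdistrib scaleR_matrix_vector_assoc)
  qed
  then have "(\<lambda>j. ?a (Suc j) *v x) sums (mexp X *v x - x)"
    by (subst sums_Suc_iff[of "\<lambda>j. ?a j *v x"]) simp
  then have lim: "(\<lambda>n. \<Sum>j<n. ?a (Suc j) *v x) \<longlonglongrightarrow> mexp X *v x - x"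
    by (simp add: sums_def)
  have mem: "(\<Sum>j<n. ?a (Suc j) *v x) \<in> S" for n
    unfolding scaleR_matrix_vector_assoc[symmetric]
    by (intro subspace_sum[OF S(1)] subspace_scale[OF S(1)] iter)
  show ?thesis
    by (rule closed_sequentially[OF closed_subspace[OF S(1)] _ lim]) (rule mem)
qed

lemma mexp_cube_zero:
  fixes X :: "real^'k^'k::finite"
  assumes "X ** (X ** X) = 0"
  shows "mexp X = mat 1 + X + (1 / 2) *\<^sub>R (X ** X)"
proof -
  have z: "((**) X ^^ k) (0 :: real^'k^'k) = 0" for k
    by (induction k) auto
  have zero: "((**) X ^^ j) (mat 1) = 0" if "j \<notin> {..<3}" for j
  proof -
    have "((**) X ^^ j) (mat 1) = ((**) X ^^ (j - 3)) (((**) X ^^ 3) (mat 1))"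
      using that by (simp flip: funpow_add[THEN fun_cong, unfolded o_apply])
    then show ?thesis
      using z assms by (simp add: numeral_3_eq_3)
  qed
  have "mexp X = (\<Sum>j<3. (1 / fact j) *\<^sub>R (((**) X ^^ j) (mat 1)))"
    unfolding mexp_def using zero by (intro suminf_finite) auto
  then show ?thesis by (simp add: numeral_3_eq_3)
qed

section \<open>Null rotations\<close>

text \<open>
  The element of the Lie algebra that corresponds to the bivector spanned by \<open>u\<close> and \<open>z\<close>. For a null
  vector \<open>u\<close> orthogonal to \<open>z\<close> it generates the one-parameter group of null rotations (Eichler
  transformations) about \<open>u\<close> in the direction \<open>z\<close>.
\<close>

definition biv :: "real^(4 + 'm::finite) \<Rightarrow> real^(4 + 'm) \<Rightarrow> real^(4 + 'm)^(4 + 'm)" where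
  "biv u z = matrix (\<lambda>x. ip u x *\<^sub>R z - ip z x *\<^sub>R u)"

lemma biv_apply: "biv u z *v x = ip u x *\<^sub>R z - ip z x *\<^sub>R u"
proof -
  have "linear (\<lambda>x. ip u x *\<^sub>R z - ip z x *\<^sub>R u)"
    by (auto intro!: linearI simp: ip_linear algebra_simps)
  then show ?thesis by (simp add: biv_def)
qed

lemma biv_linear:
  "biv u (y + z) = biv u y + biv u z" "biv u (r *\<^sub>R z) = r *\<^sub>R biv u z" "biv u 0 = 0"
  "biv u u = 0"
  by (simp_all add: matrix_eq biv_apply ip_linear algebra_simps matrix_vector_mult_add_rdistrib
      flip: scaleR_matrix_vector_assoc)

text \<open>
  The cube of \<open>biv u z\<close> vanishes: the first application lands in the span of \<open>u\<close> and \<open>z\<close>, the second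
  in the line of \<open>u\<close>, and \<open>u\<close> is orthogonal to both.
\<close>

lemma mexp_biv:
  assumes "ip u u = 0" "ip u z = 0"
  shows "mexp (biv u z) *v x =
    x + ip u x *\<^sub>R z - ip z x *\<^sub>R u - (ip u x * ip z z / 2) *\<^sub>R u"
proof -
  have "ip z u = 0" using assms ip_commute by metis
  note o = assms this
  have "biv u z ** (biv u z ** biv u z) = 0"
    by (simp add: matrix_eq biv_apply ip_linear o flip: matrix_vector_mul_assoc)
  from mexp_cube_zero[OF this] show ?thesis
    by (simp add: matrix_vector_mult_add_rdistrib biv_apply ip_linear o algebra_simps
        flip: scaleR_matrix_vector_assoc matrix_vector_mul_assoc)
qed

text \<open>
  The determinant is 1, and not \<open>- 1\<close>, because the null rotation is the square of the one for half of \<open>z\<close>.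
\<close>

lemma mexp_biv_SO:
  assumes "ip u u = 0" "ip u z = 0"
  shows "mexp (biv u z) \<in> SO_2n"
proof -
  have iso: "ip (mexp (biv u z) *v x) (mexp (biv u z) *v y) = ip x y" if "ip u z = 0" for x y z
  proof -
    have "ip z u = 0" using that ip_commute by metis
    then show ?thesis
      using that assms(1)
      by (simp add: mexp_biv ip_linear ip_commute[of x u] ip_commute[of x z] field_simps)
  qed
  let ?h = "mexp (biv u ((1 / 2) *\<^sub>R z))"
  have "ip z u = 0" using assms(2) ip_commute by metis
  then have "mexp (biv u z) = ?h ** ?h"
    using assms
    by (simp add: matrix_eq vec_eq_iff mexp_biv ip_linear field_simps flip: matrix_vector_mul_assoc)
  moreover have "det ?h * det ?h = 1"
    by (rule sq_det_isometry) (use iso assms in \<open>simp add: ip_linear\<close>)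
  ultimately have "det (mexp (biv u z)) = 1"
    by (simp add: det_mul)
  then show ?thesis
    using iso[OF assms(2)] by (auto simp: SO_2n_def)
qed

text \<open>
  Null rotations lie in the identity component: letting the parameter run over the real line joins
  them to the identity by a path of special isometries.
\<close>

lemma biv_in_so:
  assumes "ip u u = 0" "ip u z = 0"
  shows "biv u z \<in> so_2n"
proof -
  have "mexp (biv u z) \<in> SO0_2n" if z: "ip u z = 0" for z
  proof -
    define g where "g s = mexp (biv u (s *\<^sub>R z))" for s
    have sq: "g s = mat 1 + s *\<^sub>R biv u z + (s * s / 2) *\<^sub>R (biv u z ** biv u z)" for s
    proof -
      have "ip z u = 0" using z ip_commute by metis
      then show ?thesis
      using z assms(1)
      by (simp add: g_def matrix_eq mexp_biv biv_apply ip_linear matrix_vector_mult_add_rdistrib algebra_simps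
         flip: scaleR_matrix_vector_assoc matrix_vector_mul_assoc)
    qed
    have "connected (g ` UNIV)"
      unfolding sq by (intro connected_continuous_image continuous_intros) auto
    moreover have "g ` UNIV \<subseteq> SO_2n"
      using z assms(1) by (auto simp: g_def ip_linear intro!: mexp_biv_SO)
    moreover have "mat 1 \<in> g ` UNIV"
      by (rule image_eqI[of _ _ 0]) (auto simp: sq)
    moreover have "mexp (biv u z) \<in> g ` UNIV"
      by (rule image_eqI[of _ _ 1]) (auto simp: g_def)
    ultimately show ?thesis
      unfolding SO0_2n_def mem_Collect_eq connected_component_def by blast
  qed
  then show ?thesis
    using assms(2) by (auto simp: so_2n_def Lie_algebra_def ip_linear simp flip: biv_linear(2))
qed

text \<open>
  The source of transitivity. The direction is chosen such that the exponential moves \<open>p\<close> to \<open>x\<close>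
  up to a multiple of \<open>u\<close>, and the coefficient of \<open>u\<close> is proportional to \<open>ip p p - ip x x\<close>.
\<close>

lemma mexp_biv_transvection:
  assumes u: "ip u u = 0" "ip u p \<noteq> 0" and x: "ip u (x - p) = 0" "ip x x = ip p p"
  shows "mexp (biv u ((1 / ip u p) *\<^sub>R (x - p))) *v p = x"
proof -
  have "mexp (biv u ((1 / ip u p) *\<^sub>R (x - p))) *v p
      = x + ((ip p p - ip x x) / (2 * ip u p)) *\<^sub>R u"
    using u x(1)
    by (simp add: mexp_biv ip_linear ip_commute[of p x] field_simps
        scaleR_left_diff_distrib[symmetric] scaleR_left_distrib[symmetric] )
  then show ?thesis using x(2) by simp
qed

section \<open>Weight vectors and the nilpotent algebra\<close>

text \<open>
  Weight vectors of \<open>\<aa>_alg\<close> on the ambient space: \<open>H_mat a b\<close> acts on them by \<open>a\<close>, \<open>- a\<close> and \<open>b\<close>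
  respectively, and vectors supported on the last coordinates have weight 0. In terms of them, \<open>\<W>\<close> is
  the orthogonal complement of \<open>u\<^sub>b\<close> and \<open>\<V>\<close> that of \<open>u\<^sub>a\<close> and \<open>u\<^sub>b\<close>.
\<close>

definition u\<^sub>a :: "real^(4 + 'm::finite)" where "u\<^sub>a = axis (Inl 1) 1 + axis (Inl 3) 1"
definition u\<^sub>a\<^sub>' :: "real^(4 + 'm::finite)" where "u\<^sub>a\<^sub>' = axis (Inl 1) 1 - axis (Inl 3) 1"
definition u\<^sub>b :: "real^(4 + 'm::finite)" where "u\<^sub>b = axis (Inl 2) 1 + axis (Inl 4) 1"

lemma weight_vector_coordinates:
  "u\<^sub>a $ Inl 1 = 1" "u\<^sub>a $ Inl 2 = 0" "u\<^sub>a $ Inl 3 = 1" "u\<^sub>a $ Inl 4 = 0" "u\<^sub>a $ Inr j = 0"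
  "u\<^sub>a\<^sub>' $ Inl 1 = 1" "u\<^sub>a\<^sub>' $ Inl 2 = 0" "u\<^sub>a\<^sub>' $ Inl 3 = - 1" "u\<^sub>a\<^sub>' $ Inl 4 = 0" "u\<^sub>a\<^sub>' $ Inr j = 0"
  "u\<^sub>b $ Inl 1 = 0" "u\<^sub>b $ Inl 2 = 1" "u\<^sub>b $ Inl 3 = 0" "u\<^sub>b $ Inl 4 = 1" "u\<^sub>b $ Inr j = 0"
  by (simp_all add: u\<^sub>a_def u\<^sub>a\<^sub>'_def u\<^sub>b_def axis_def)

lemma ip_weight_vectors:
  "ip u\<^sub>a x = x $ Inl 3 - x $ Inl 1" "ip x u\<^sub>a = x $ Inl 3 - x $ Inl 1"
  "ip u\<^sub>b x = x $ Inl 4 - x $ Inl 2" "ip x u\<^sub>b = x $ Inl 4 - x $ Inl 2"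
  by (simp_all add: ip_def weight_vector_coordinates)

lemma H_mat_apply:
  "(H_mat a b *v x) $ Inl 1 = a * x $ Inl 3" "(H_mat a b *v x) $ Inl 3 = a * x $ Inl 1"
  "(H_mat a b *v x) $ Inl 2 = b * x $ Inl 4" "(H_mat a b *v x) $ Inl 4 = b * x $ Inl 2"
  "(H_mat a b *v x) $ Inr j = 0"
  by (simp_all add: H_mat_def matrix_vector_mult_def sum_coordinates)

lemma H_mat_skew: "ip (H_mat a b *v x) y = - ip x (H_mat a b *v y)"
  by (simp add: ip_def H_mat_apply)

text \<open>
  A skew \<open>H\<close> acts on bivectors as a derivation, so the weights of \<open>u\<close> and \<open>z\<close> add up.
\<close>

lemma biv_in_root_space:
  assumes "ip u u = 0" "ip u z = 0"
    and u: "\<And>a b. H_mat a b *v u = \<rho> a b *\<^sub>R u"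
    and z: "\<And>a b. H_mat a b *v z = \<kappa> a b *\<^sub>R z"
    and \<mu>: "\<And>a b. \<mu> (H_mat a b) = \<rho> a b + \<kappa> a b"
  shows "biv u z \<in> root_space \<mu>"
proof -
  have *: "ip v (H_mat a b *v x) = - ip (H_mat a b *v v) x" for a b v x
    by (simp add: H_mat_skew)
  have "lie_bracket (H_mat a b) (biv u z) = \<mu> (H_mat a b) *\<^sub>R biv u z" for a b
  proof -
    have "lie_bracket (H_mat a b) (biv u z) *v x = (\<mu> (H_mat a b) *\<^sub>R biv u z) *v x" for x
      by (simp add: lie_bracket_def matrix_vector_mult_diff_rdistrib biv_apply ip_linear
          matrix_vector_mult_diff_distrib matrix_vector_mult_scaleR * u z \<mu> algebra_simps
          flip: scaleR_matrix_vector_assoc matrix_vector_mul_assoc)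
    then show ?thesis by (simp add: matrix_eq)
  qed
  then show ?thesis
    using biv_in_so[OF assms(1,2)] by (auto simp: root_space_def \<aa>_alg_def)
qed

lemma zero_in_root_space: "0 \<in> root_space \<mu>"
proof -
  have "biv 0 0 \<in> so_2n" by (rule biv_in_so) (simp_all add: ip_linear)
  then show ?thesis
    by (simp add: root_space_def lie_bracket_def biv_linear)
qed

lemma root_values:
  "\<alpha>\<^sub>1 (H_mat a b) = b - a" "\<alpha>\<^sub>2 (H_mat a b) = a"
  by (simp_all add: \<alpha>\<^sub>1_def \<alpha>\<^sub>2_def H_mat_def)

text \<open>
  Up to a multiple of \<open>u\<^sub>b\<close>, which contributes nothing, \<open>z\<close> is a sum of vectors of weights \<open>- a\<close>, \<open>0\<close>
  and \<open>a\<close>. Adding the weight \<open>b\<close> of \<open>u\<^sub>b\<close> gives the roots \<open>\<alpha>\<^sub>1\<close>, \<open>\<alpha>\<^sub>1 + \<alpha>\<^sub>2\<close> and \<open>\<alpha>\<^sub>1 + 2 \<alpha>\<^sub>2\<close>.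
\<close>

lemma biv_u\<^sub>b_in_\<nn>:
  fixes z :: "real^(4 + 'm::finite)"
  assumes "z \<in> \<W>"
  shows "biv u\<^sub>b z \<in> \<nn>_alg"
proof -
  define y :: "real^(4 + 'm)" where "y = (\<chi> i. case i of Inl _ \<Rightarrow> 0 | Inr j \<Rightarrow> z $ Inr j)"
  let ?r = "(z $ Inl 1 - z $ Inl 3) / 2" and ?s = "(z $ Inl 1 + z $ Inl 3) / 2"
  have z: "z = ?r *\<^sub>R u\<^sub>a\<^sub>' + y + ?s *\<^sub>R u\<^sub>a + z $ Inl 2 *\<^sub>R u\<^sub>b"
    using assms by (simp add: vec_eq_iff all_coordinates weight_vector_coordinates y_def \<W>_def field_simps)
  have "biv u\<^sub>b (?r *\<^sub>R u\<^sub>a\<^sub>') \<in> root_space \<alpha>\<^sub>1"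
    by (rule biv_in_root_space[where \<rho> = "\<lambda>a b. b" and \<kappa> = "\<lambda>a b. - a"])
      (auto simp: ip_weight_vectors weight_vector_coordinates vec_eq_iff all_coordinates H_mat_apply root_values)
  moreover have "biv u\<^sub>b y \<in> root_space (\<lambda>H. \<alpha>\<^sub>1 H + \<alpha>\<^sub>2 H)"
    by (rule biv_in_root_space[where \<rho> = "\<lambda>a b. b" and \<kappa> = "\<lambda>a b. 0"])
      (auto simp: ip_weight_vectors weight_vector_coordinates vec_eq_iff all_coordinates H_mat_apply root_values y_def)
  moreover have "biv u\<^sub>b (?s *\<^sub>R u\<^sub>a) \<in> root_space (\<lambda>H. \<alpha>\<^sub>1 H + 2 * \<alpha>\<^sub>2 H)"
    by (rule biv_in_root_space[where \<rho> = "\<lambda>a b. b" and \<kappa> = "\<lambda>a b. a"])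
      (auto simp: ip_weight_vectors weight_vector_coordinates vec_eq_iff all_coordinates H_mat_apply root_values)
  moreover have "biv u\<^sub>b z = biv u\<^sub>b (?r *\<^sub>R u\<^sub>a\<^sub>') + 0 + biv u\<^sub>b y + biv u\<^sub>b (?s *\<^sub>R u\<^sub>a)"
    by (subst z) (simp add: biv_linear)
  ultimately show ?thesis
    using zero_in_root_space[of \<alpha>\<^sub>2] unfolding \<nn>_alg_def by blast
qed

text \<open>
  Here \<open>z\<close> has parts of weights \<open>0\<close> and \<open>b\<close> besides a multiple of \<open>u\<^sub>a\<close>; adding the weight \<open>a\<close> of \<open>u\<^sub>a\<close>
  gives the roots \<open>\<alpha>\<^sub>2\<close> and \<open>\<alpha>\<^sub>1 + 2 \<alpha>\<^sub>2\<close>.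
\<close>

lemma biv_u\<^sub>a_in_\<nn>:
  fixes z :: "real^(4 + 'm::finite)"
  assumes "z \<in> \<V>"
  shows "biv u\<^sub>a z \<in> \<nn>_alg"
proof -
  define y :: "real^(4 + 'm)" where "y = (\<chi> i. case i of Inl _ \<Rightarrow> 0 | Inr j \<Rightarrow> z $ Inr j)"
  have z: "z = y + z $ Inl 2 *\<^sub>R u\<^sub>b + z $ Inl 1 *\<^sub>R u\<^sub>a"
    using assms by (simp add: vec_eq_iff all_coordinates weight_vector_coordinates y_def \<V>_def field_simps)
  have "biv u\<^sub>a y \<in> root_space \<alpha>\<^sub>2"
    by (rule biv_in_root_space[where \<rho> = "\<lambda>a b. a" and \<kappa> = "\<lambda>a b. 0"])
      (auto simp: ip_weight_vectors weight_vector_coordinates vec_eq_iff all_coordinates H_mat_apply root_values y_def)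
  moreover have "biv u\<^sub>a (z $ Inl 2 *\<^sub>R u\<^sub>b) \<in> root_space (\<lambda>H. \<alpha>\<^sub>1 H + 2 * \<alpha>\<^sub>2 H)"
    by (rule biv_in_root_space[where \<rho> = "\<lambda>a b. a" and \<kappa> = "\<lambda>a b. b"])
      (auto simp: ip_weight_vectors weight_vector_coordinates vec_eq_iff all_coordinates H_mat_apply root_values)
  moreover have "biv u\<^sub>a z = 0 + biv u\<^sub>a y + 0 + biv u\<^sub>a (z $ Inl 2 *\<^sub>R u\<^sub>b)"
    by (subst z) (simp add: biv_linear)
  ultimately show ?thesis
    using zero_in_root_space[of \<alpha>\<^sub>1] zero_in_root_space[of "\<lambda>H. \<alpha>\<^sub>1 H + \<alpha>\<^sub>2 H"]
    unfolding \<nn>_alg_def by blast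
qed

lemma subspace_W: "subspace \<W>" and subspace_V: "subspace \<V>"
  by (auto simp: subspace_def \<W>_def \<V>_def)

text \<open>
  A root vector shifts the eigenvalues of \<open>H_mat 1 2\<close>, which are \<open>-2, -1, 0, 1, 2\<close>, upwards by at least
  1. The eigenvalue \<open>-2\<close> is therefore never reached, and the image lies in the span \<open>\<W>\<close> of the other
  eigenspaces. On \<open>\<W>\<close> the eigenvalue \<open>-1\<close> is not reached either, which leaves \<open>\<V>\<close>. The point
  \<open>a = 1\<close>, \<open>b = 2\<close> is chosen inside the positive Weyl chamber; the positive roots take the values
  1, 1, 2, 3 there.
\<close>

lemma root_space_raises:
  fixes X :: "real^(4 + 'm::finite)^(4 + 'm)"
  assumes X: "X \<in> root_space \<mu>" and \<mu>: "\<mu> (H_mat 1 2) \<in> {1, 2, 3}"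
  shows "X *v x \<in> \<W>" and "x \<in> \<W> \<Longrightarrow> X *v x \<in> \<V>"
proof -
  define k where "k = \<mu> (H_mat 1 2)"
  have "H_mat 1 2 ** X - X ** H_mat 1 2 = k *\<^sub>R X"
    using X by (auto simp: root_space_def \<aa>_alg_def lie_bracket_def k_def)
  then have br: "(H_mat 1 2 ** X) $ i $ j - (X ** H_mat 1 2) $ i $ j = k * X $ i $ j" for i j
    by (metis vector_minus_component vector_scaleR_component real_scaleR_def)
  have left: "(H_mat 1 2 ** X) $ Inl 1 $ j = X $ Inl 3 $ j" "(H_mat 1 2 ** X) $ Inl 3 $ j = X $ Inl 1 $ j"
    "(H_mat 1 2 ** X) $ Inl 2 $ j = 2 * X $ Inl 4 $ j" "(H_mat 1 2 ** X) $ Inl 4 $ j = 2 * X $ Inl 2 $ j" for j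
    by (simp_all add: matrix_matrix_mult_def H_mat_def sum_coordinates)
  have right: "(X ** H_mat 1 2) $ i $ Inl 1 = X $ i $ Inl 3" "(X ** H_mat 1 2) $ i $ Inl 3 = X $ i $ Inl 1"
    "(X ** H_mat 1 2) $ i $ Inl 2 = 2 * X $ i $ Inl 4" "(X ** H_mat 1 2) $ i $ Inl 4 = 2 * X $ i $ Inl 2"
    "(X ** H_mat 1 2) $ i $ Inr l = 0" for i l
    by (simp_all add: matrix_matrix_mult_def H_mat_def sum_coordinates)
  have k: "k = 1 \<or> k = 2 \<or> k = 3" using \<mu> by (auto simp: k_def)
  \<comment> \<open>The two functionals \<open>x\<^sub>2 - x\<^sub>4\<close> and \<open>x\<^sub>1 - x\<^sub>3\<close> are left eigenvectors of \<open>H_mat 1 2\<close> for \<open>-2\<close> and \<open>-1\<close>.\<close>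
  have R: "- (2 + k) * (X $ Inl 2 $ j - X $ Inl 4 $ j)
      = (X ** H_mat 1 2) $ Inl 2 $ j - (X ** H_mat 1 2) $ Inl 4 $ j"
    and Q: "- (1 + k) * (X $ Inl 1 $ j - X $ Inl 3 $ j)
      = (X ** H_mat 1 2) $ Inl 1 $ j - (X ** H_mat 1 2) $ Inl 3 $ j" for j
    using br[of "Inl 1" j] br[of "Inl 2" j] br[of "Inl 3" j] br[of "Inl 4" j]
    unfolding left by (simp_all add: algebra_simps)
  have rows: "X $ Inl 2 $ Inl 1 = X $ Inl 4 $ Inl 1" "X $ Inl 2 $ Inl 3 = X $ Inl 4 $ Inl 3"
    using R[of "Inl 1"] R[of "Inl 3"] k unfolding right by auto
  have rows2: "X $ Inl 2 $ Inl 2 = X $ Inl 4 $ Inl 2" "X $ Inl 2 $ Inl 4 = X $ Inl 4 $ Inl 4"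
    using R[of "Inl 2"] R[of "Inl 4"] k unfolding right by auto
  have rows3: "X $ Inl 1 $ Inl 1 = X $ Inl 3 $ Inl 1" "X $ Inl 1 $ Inl 3 = X $ Inl 3 $ Inl 3"
    using Q[of "Inl 1"] Q[of "Inl 3"] k unfolding right by auto
  have rows4: "X $ Inl 1 $ Inl 4 = X $ Inl 3 $ Inl 4 + X $ Inl 3 $ Inl 2 - X $ Inl 1 $ Inl 2"
    using Q[of "Inl 2"] Q[of "Inl 4"] k unfolding right by auto
  have rows': "X $ Inl 2 $ Inr l = X $ Inl 4 $ Inr l" "X $ Inl 1 $ Inr l = X $ Inl 3 $ Inr l" for l
    using R[of "Inr l"] Q[of "Inr l"] k unfolding right by auto
  note rows = rows rows2 rows3 rows'
  show W: "X *v x \<in> \<W>"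
    by (simp add: \<W>_def matrix_vector_mult_def sum_coordinates rows)
  show "X *v x \<in> \<V>" if "x \<in> \<W>"
  proof -
    have "(X *v x) $ Inl 1 - (X *v x) $ Inl 3
        = (X $ Inl 1 $ Inl 2 - X $ Inl 3 $ Inl 2) * (x $ Inl 2 - x $ Inl 4)"
      by (simp add: matrix_vector_mult_def sum_coordinates rows rows4 algebra_simps)
    then show ?thesis
      using that W by (simp add: \<W>_def \<V>_def)
  qed
qed

lemma \<nn>_raises:
  assumes "X \<in> \<nn>_alg"
  shows "X *v x \<in> \<W>" and "x \<in> \<W> \<Longrightarrow> X *v x \<in> \<V>"
proof -
  obtain X1 X2 X3 X4 where X: "X = X1 + X2 + X3 + X4"
    and r: "X1 \<in> root_space \<alpha>\<^sub>1" "X2 \<in> root_space \<alpha>\<^sub>2"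
      "X3 \<in> root_space (\<lambda>H. \<alpha>\<^sub>1 H + \<alpha>\<^sub>2 H)" "X4 \<in> root_space (\<lambda>H. \<alpha>\<^sub>1 H + 2 * \<alpha>\<^sub>2 H)"
    using assms unfolding \<nn>_alg_def by blast
  note rr = r[THEN root_space_raises(1)] r[THEN root_space_raises(2)]
  show "X *v x \<in> \<W>" "x \<in> \<W> \<Longrightarrow> X *v x \<in> \<V>"
    unfolding X matrix_vector_mult_add_rdistrib
    using rr by (auto intro!: subspace_add subspace_W subspace_V simp: root_values)
qed

section \<open>Orbits as affine slices\<close>

lemma product_of_mexp_displacement:
  fixes x :: "real^'k::finite"
  assumes S: "subspace S" "S \<subseteq> T" and T: "subspace T" and x: "x \<in> T"
    and Xs: "\<And>X y. X \<in> set Xs \<Longrightarrow> y \<in> T \<Longrightarrow> X *v y \<in> S"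
  shows "foldr (\<lambda>X g. mexp X ** g) Xs (mat 1) *v x - x \<in> S"
  using Xs
proof (induction Xs)
  case Nil
  then show ?case using S(1) by (simp add: subspace_0)
next
  case (Cons X Xs)
  let ?y = "foldr (\<lambda>X g. mexp X ** g) Xs (mat 1) *v x"
  have y: "?y - x \<in> S" using Cons by simp
  then have "x + (?y - x) \<in> T" using S(2) x by (blast intro: subspace_add[OF T])
  then have "mexp X *v ?y - ?y \<in> S"
    using Cons.prems by (intro mexp_displacement[OF S]) auto
  from subspace_add[OF S(1) this y] show ?case
    by (simp flip: matrix_vector_mul_assoc)
qed

lemma mem_AdS_slice: "x \<in> AdS \<inter> (\<lambda>x. p + x) ` L \<longleftrightarrow> x \<in> AdS \<and> x - p \<in> L"
  by (auto intro!: image_eqI[of _ _ "x - p"])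

text \<open>
  The hypothesis \<open>disp\<close> confines the orbit to the slice; conversely, since \<open>u\<close> is orthogonal to \<open>L\<close>,
  a single null rotation about \<open>u\<close> carries \<open>p\<close> to any other point of the slice.
\<close>

lemma orbit_eq_slice:
  fixes p :: "real^(4 + 'm::finite)"
  assumes grp: "matrix_group N" "N \<subseteq> SO_2n" and p: "p \<in> AdS"
    and disp: "\<And>g. g \<in> N \<Longrightarrow> g *v p - p \<in> L" and L: "subspace L"
    and u: "ip u u = 0" "ip u p \<noteq> 0" "\<And>z. z \<in> L \<Longrightarrow> ip u z = 0"
    and exp: "\<And>z. z \<in> L \<Longrightarrow> mexp (biv u z) \<in> N"
  shows "orbit N p = AdS \<inter> (\<lambda>x. p + x) ` L"
proof (intro equalityI subsetI; unfold mem_AdS_slice)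
  fix x assume "x \<in> orbit N p"
  then obtain g where g: "g \<in> N" "x = g *v p" by (auto simp: orbit_def)
  then show "x \<in> AdS \<and> x - p \<in> L"
    using grp p disp by (auto simp: AdS_def SO_2n_def)
next
  fix x assume x: "x \<in> AdS \<and> x - p \<in> L"
  have "mexp (biv u ((1 / ip u p) *\<^sub>R (x - p))) *v p = x"
    using x p u by (intro mexp_biv_transvection) (auto simp: AdS_def)
  moreover have "mexp (biv u ((1 / ip u p) *\<^sub>R (x - p))) \<in> N"
    using x subspace_scale[OF L] by (intro exp) auto
  ultimately show "x \<in> orbit N p"
    unfolding orbit_def by force
qed

text \<open>
  Otherwise the two negative squares would cancel against those of \<open>x\<^sub>3\<close> and \<open>x\<^sub>4\<close>, and \<open>ip x x\<close> could not
  be \<open>- 1\<close>. This is why a point always has a non-zero product with \<open>u\<^sub>a\<close> or \<open>u\<^sub>b\<close>.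
\<close>

lemma AdS_degenerate:
  assumes "x \<in> AdS" "x $ Inl 2 = x $ Inl 4"
  shows "x $ Inl 1 \<noteq> x $ Inl 3"
proof
  assume "x $ Inl 1 = x $ Inl 3"
  then have "ip x x = (\<Sum>j\<in>UNIV. x $ Inr j * x $ Inr j)"
    using assms(2) by (simp add: ip_def)
  also have "\<dots> \<ge> 0" by (simp add: sum_nonneg)
  finally show False using assms(1) by (simp add: AdS_def)
qed

lemma AdS_points:
  assumes "c \<noteq> 0"
  shows "\<exists>x\<in>AdS :: (real^(4 + 'm::finite)) set. x $ Inl 2 - x $ Inl 4 = c"
    and "\<exists>x\<in>AdS :: (real^(4 + 'm::finite)) set. x $ Inl 2 = x $ Inl 4 \<and> x $ Inl 1 - x $ Inl 3 = c"
proof -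
  have *: "((1 / c + c) / 2)\<^sup>2 - ((1 / c - c) / 2)\<^sup>2 = 1"
    using assms by (simp add: field_simps power2_eq_square)
  show "\<exists>x\<in>AdS :: (real^(4 + 'm)) set. x $ Inl 2 - x $ Inl 4 = c"
    using * by (intro bexI[of _ "axis (Inl 2) ((1 / c + c) / 2) + axis (Inl 4) ((1 / c - c) / 2)"])
      (auto simp: AdS_def ip_def axis_def power2_eq_square field_simps)
  show "\<exists>x\<in>AdS :: (real^(4 + 'm)) set. x $ Inl 2 = x $ Inl 4 \<and> x $ Inl 1 - x $ Inl 3 = c"
    using * by (intro bexI[of _ "axis (Inl 1) ((1 / c + c) / 2) + axis (Inl 3) ((1 / c - c) / 2)"])
      (auto simp: AdS_def ip_def axis_def power2_eq_square field_simps)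
qed

lemma linear_ip_right: "linear (ip x)"
  by (rule bounded_linear.linear[OF ip.bounded_linear_right])

section \<open>Tangent spaces and dimensions\<close>

lemma dim_kernel:
  fixes f :: "'a::euclidean_space \<Rightarrow> real"
  assumes L: "subspace L" and f: "linear f" and u: "u \<in> L" "f u \<noteq> 0"
  shows "dim {v \<in> L. f v = 0} + 1 = dim L"
proof -
  let ?K = "{v \<in> L. f v = 0}"
  have K: "subspace ?K"
    using L f by (auto simp: subspace_def linear_0 linear_add linear_cmul)
  have "L \<subseteq> span (insert u ?K)"
  proof
    fix v assume v: "v \<in> L"
    have "v - (f v / f u) *\<^sub>R u \<in> ?K"
      using v u L f by (auto intro!: subspace_diff subspace_scale simp: linear_diff linear_cmul)
    then have "v - (f v / f u) *\<^sub>R u \<in> span ?K" by (rule span_base)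
    then show "v \<in> span (insert u ?K)"
      unfolding span_insert by blast
  qed
  moreover have "insert u ?K \<subseteq> L" using u by auto
  ultimately have "dim L = dim (insert u ?K)"
    by (metis dim_span dim_subset le_antisym span_minimal L)
  moreover have "u \<notin> span ?K"
    using u K by (simp add: span_eq_iff[THEN iffD2])
  ultimately show ?thesis by (simp add: dim_insert)
qed

text \<open>
  For one inclusion, differentiate the quadratic equation of the slice along a curve. For the other,
  the line \<open>p + t v\<close> is corrected by a multiple of the null vector \<open>u\<close>: the value of \<open>ip x x\<close> at
  \<open>x = p + t v + s u\<close> is an affine function of \<open>s\<close> with slope close to \<open>2 * ip p u\<close>, so for small
  \<open>t\<close> the coefficient \<open>s\<close> that keeps the curve in the quadric is an explicit rational function of \<open>t\<close>, of second order at 0.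
\<close>

lemma tangent_space_AdS_slice:
  fixes p :: "real^(4 + 'm::finite)"
  assumes p: "p \<in> AdS" and L: "subspace L" and u: "u \<in> L" "ip u u = 0" "ip p u \<noteq> 0"
  shows "tangent_space (AdS \<inter> (\<lambda>x. p + x) ` L) p = {v \<in> L. ip p v = 0}"
proof (intro equalityI subsetI)
  fix v assume "v \<in> tangent_space (AdS \<inter> (\<lambda>x. p + x) ` L) p"
  then obtain \<epsilon> c c' where \<epsilon>: "\<epsilon> > 0" and c0: "c 0 = p" "c' 0 = v"
    and c: "\<And>t. t \<in> {-\<epsilon><..<\<epsilon>} \<Longrightarrow> c t \<in> AdS \<and> c t - p \<in> L"
    and d: "\<And>t. t \<in> {-\<epsilon><..<\<epsilon>} \<Longrightarrow> (c has_vector_derivative c' t) (at t)"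
    unfolding tangent_space_def mem_Collect_eq mem_AdS_slice by blast
  have d0: "(c has_vector_derivative v) (at 0)"
    using d[of 0] \<epsilon> c0 by simp
  have near: "eventually (\<lambda>t. t \<in> {-\<epsilon><..<\<epsilon>}) (nhds (0::real))"
    using \<epsilon> by (intro eventually_nhds_in_open) auto
  have "((\<lambda>t. norm (c t - p - t *\<^sub>R v) / norm t) \<longlongrightarrow> 0) (at 0)"
    using d0 by (simp add: has_vector_derivative_def has_derivative_at c0)
  then have "((\<lambda>t. norm ((1 / t) *\<^sub>R (c t - p) - v)) \<longlongrightarrow> 0) (at 0)"
  proof (rule Lim_transform_eventually)
    have "norm (c t - p - t *\<^sub>R v) / norm t = norm ((1 / t) *\<^sub>R (c t - p) - v)" if "t \<noteq> 0" for t
    proof -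
      have "(1 / t) *\<^sub>R (c t - p) - v = (1 / t) *\<^sub>R (c t - p - t *\<^sub>R v)"
        using that by (simp add: scaleR_diff_right)
      then show ?thesis by simp
    qed
    then show "\<forall>\<^sub>F t in at 0. norm (c t - p - t *\<^sub>R v) / norm t = norm ((1 / t) *\<^sub>R (c t - p) - v)"
      by (simp add: eventually_at_filter)
  qed
  then have "((\<lambda>t. (1 / t) *\<^sub>R (c t - p)) \<longlongrightarrow> v) (at 0)"
    by (rule LIM_zero_cancel[OF tendsto_norm_zero_cancel])
  moreover have "eventually (\<lambda>t. (1 / t) *\<^sub>R (c t - p) \<in> L) (at 0)"
    using near unfolding eventually_at_filter
    by (rule eventually_mono) (use subspace_scale[OF L] c in simp)
  ultimately have "v \<in> L"
    using closed_subspace[OF L] by (intro Lim_in_closed_set) auto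
  moreover have "ip p v = 0"
  proof -
    have "((\<lambda>t. ip (c t) (c t)) has_vector_derivative ip p v + ip v p) (at 0)"
      using ip.has_vector_derivative[OF d0 d0] by (simp add: c0)
    moreover have "((\<lambda>t. ip (c t) (c t)) has_vector_derivative 0) (at 0)"
    proof (rule has_vector_derivative_transform_within_open[of "\<lambda>_. - 1"])
      show "open {-\<epsilon><..<\<epsilon>}" "0 \<in> {-\<epsilon><..<\<epsilon>}" using \<epsilon> by auto
      show "- 1 = ip (c t) (c t)" if "t \<in> {-\<epsilon><..<\<epsilon>}" for t
        using c[OF that] by (simp add: AdS_def)
    qed auto
    ultimately have "ip p v + ip v p = 0"
      by (rule vector_derivative_unique_at)
    then show ?thesis by (simp add: ip_commute[of v p])
  qed
  ultimately show "v \<in> {v \<in> L. ip p v = 0}" by blast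
next
  fix v assume v: "v \<in> {v \<in> L. ip p v = 0}"
  define \<sigma> \<beta> Q where "\<sigma> = ip p u" and "\<beta> = ip v u" and "Q = ip v v"
  \<comment> \<open>For \<open>\<bar>t\<bar> < \<epsilon>\<close> the slope \<open>2 * (\<sigma> + t * \<beta>)\<close> does not vanish; the added 1 covers \<open>\<beta> = 0\<close>.\<close>
  define \<epsilon> where "\<epsilon> = \<bar>\<sigma>\<bar> / (\<bar>\<beta>\<bar> + 1)"
  define f where "f t = - (t\<^sup>2 * Q / (2 * (\<sigma> + t * \<beta>)))" for t
  define f' where "f' t = - ((2 * t * Q * (2 * (\<sigma> + t * \<beta>)) - t\<^sup>2 * Q * (2 * \<beta>)) / (2 * (\<sigma> + t * \<beta>))\<^sup>2)" for t
  define c where "c t = p + t *\<^sub>R v + f t *\<^sub>R u" for t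
  define c' where "c' t = v + f' t *\<^sub>R u" for t
  have \<sigma>: "\<sigma> \<noteq> 0" using u by (simp add: \<sigma>_def)
  have nz: "\<sigma> + t * \<beta> \<noteq> 0" if "t \<in> {-\<epsilon><..<\<epsilon>}" for t
  proof -
    have "\<bar>t * \<beta>\<bar> \<le> \<bar>t\<bar> * (\<bar>\<beta>\<bar> + 1)" by (simp add: abs_mult mult_left_mono)
    also have "\<dots> < \<bar>\<sigma>\<bar>" using that by (simp add: \<epsilon>_def field_simps abs_if split: if_splits)
    finally show ?thesis by linarith
  qed
  have ips: "ip u p = \<sigma>" "ip u v = \<beta>" "ip p u = \<sigma>" "ip v u = \<beta>" "ip v v = Q" "ip p v = 0" "ip v p = 0"
    "ip p p = - 1"
    using v p ip_commute[of v p] ip_commute[of u p] ip_commute[of u v]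
    by (auto simp: \<sigma>_def \<beta>_def Q_def AdS_def)
  have "c t \<in> AdS \<inter> (\<lambda>x. p + x) ` L" if t: "t \<in> {-\<epsilon><..<\<epsilon>}" for t
  proof -
    have "ip (c t) (c t) = - 1 + t\<^sup>2 * Q + f t * (2 * (\<sigma> + t * \<beta>))"
      by (simp add: c_def ip_linear ips u(2) power2_eq_square algebra_simps)
    also have "\<dots> = - 1" using nz[OF t] by (simp add: f_def)
    finally have "c t \<in> AdS" by (simp add: AdS_def)
    moreover have "c t - p \<in> L"
      using v u(1) L by (auto simp: c_def intro!: subspace_add subspace_scale)
    ultimately show ?thesis unfolding mem_AdS_slice by blast
  qed
  moreover have "(c has_vector_derivative c' t) (at t)" if t: "t \<in> {-\<epsilon><..<\<epsilon>}" for t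
  proof -
    have "(f has_real_derivative f' t) (at t)"
      unfolding f_def f'_def
      using nz[OF t] by (auto intro!: derivative_eq_intros simp: power2_eq_square)
    then show ?thesis
      unfolding c_def c'_def by (auto intro!: derivative_eq_intros)
  qed
  moreover have "continuous_on {-\<epsilon><..<\<epsilon>} c'"
    unfolding c'_def f'_def by (intro continuous_intros ballI) (simp add: nz del: distrib_left_numeral)
  moreover have "c 0 = p" "c' 0 = v" by (simp_all add: c_def c'_def f_def f'_def)
  moreover have "\<epsilon> > 0" using \<sigma> by (simp add: \<epsilon>_def)
  ultimately show "v \<in> tangent_space (AdS \<inter> (\<lambda>x. p + x) ` L) p"
    unfolding tangent_space_def by blast
qed

lemma mfd_dim_eqI:
  assumes "x \<in> S" "\<And>x. x \<in> S \<Longrightarrow> dim (tangent_space S x) = d"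
  shows "mfd_dim S = d"
  unfolding mfd_dim_def using assms by (intro the_equality) auto

text \<open>
  The base point of a slice may be moved within it, so the tangent space is known at every point: it is
  the kernel on \<open>L\<close> of a functional that does not vanish at the null vector.
\<close>

lemma mfd_dim_AdS_slice:
  fixes p :: "real^(4 + 'm::finite)"
  assumes p: "p \<in> AdS" and L: "subspace L"
    and u: "\<And>x. x \<in> AdS \<Longrightarrow> x - p \<in> L \<Longrightarrow> \<exists>u\<in>L. ip u u = 0 \<and> ip x u \<noteq> 0"
  shows "mfd_dim (AdS \<inter> (\<lambda>x. p + x) ` L) = dim L - 1"
proof (rule mfd_dim_eqI)
  show "p \<in> AdS \<inter> (\<lambda>x. p + x) ` L"
    using p L by (simp only: mem_AdS_slice) (simp add: subspace_0)
next
  fix x assume "x \<in> AdS \<inter> (\<lambda>x. p + x) ` L"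
  then have x: "x \<in> AdS" "x - p \<in> L" unfolding mem_AdS_slice by auto
  then obtain w where w: "w \<in> L" "ip w w = 0" "ip x w \<noteq> 0" using u by blast
  have "AdS \<inter> (\<lambda>x. p + x) ` L = AdS \<inter> (\<lambda>y. x + y) ` L"
  proof (intro set_eqI; unfold mem_AdS_slice)
    fix y
    have "y - p \<in> L \<longleftrightarrow> y - x \<in> L"
      using subspace_add[OF L x(2), of "y - x"] subspace_diff[OF L, of "y - p" "x - p"] x(2) by auto
    then show "y \<in> AdS \<and> y - p \<in> L \<longleftrightarrow> y \<in> AdS \<and> y - x \<in> L" by blast
  qed
  then have "tangent_space (AdS \<inter> (\<lambda>x. p + x) ` L) x = {v \<in> L. ip x v = 0}"
    using tangent_space_AdS_slice[OF x(1) L w] by simp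
  moreover have "dim {v \<in> L. ip x v = 0} + 1 = dim L"
    using dim_kernel[OF L linear_ip_right w(1,3)] .
  ultimately show "dim (tangent_space (AdS \<inter> (\<lambda>x. p + x) ` L) x) = dim L - 1" by simp
qed

lemma dim_W: "dim (\<W> :: (real^(4 + 'm::finite)) set) = CARD('m) + 3"
proof -
  have "dim {v :: real^(4 + 'm). v \<in> UNIV \<and> ip u\<^sub>b v = 0} + 1 = dim (UNIV :: (real^(4 + 'm)) set)"
    by (rule dim_kernel[where u = "axis (Inl 2) 1 :: real^(4 + 'm)", OF _ linear_ip_right])
      (auto simp: ip_weight_vectors axis_def)
  moreover have "{v \<in> UNIV. ip u\<^sub>b v = 0} = (\<W> :: (real^(4 + 'm)) set)"
    by (auto simp: \<W>_def ip_weight_vectors)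
  ultimately show ?thesis by simp
qed

lemma dim_V: "dim (\<V> :: (real^(4 + 'm::finite)) set) = CARD('m) + 2"
proof -
  have "dim {v :: real^(4 + 'm). v \<in> \<W> \<and> ip u\<^sub>a v = 0} + 1 = dim (\<W> :: (real^(4 + 'm)) set)"
    by (rule dim_kernel[where u = "axis (Inl 1) 1 :: real^(4 + 'm)", OF subspace_W linear_ip_right])
      (auto simp: ip_weight_vectors axis_def \<W>_def)
  moreover have "{v \<in> \<W>. ip u\<^sub>a v = 0} = (\<V> :: (real^(4 + 'm)) set)"
    by (auto simp: \<V>_def \<W>_def ip_weight_vectors)
  ultimately show ?thesis by (simp add: dim_W)
qed

section \<open>Orbits of the nilpotent group\<close>

context
  fixes N :: "(real^(4 + 'm::finite)^(4 + 'm)) set"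
  assumes N: "connected_Lie_subgroup N SO0_2n" and LieN: "Lie_algebra N = \<nn>_alg"
begin

lemma N_group: "matrix_group N" and N_SO: "N \<subseteq> SO_2n"
  using N connected_component_subset unfolding connected_Lie_subgroup_def SO0_2n_def by blast+

lemma N_displacement:
  assumes "g \<in> N"
  shows "g *v p - p \<in> \<W>" and "p \<in> \<W> \<Longrightarrow> g *v p - p \<in> \<V>"
proof -
  obtain Xs where Xs: "set Xs \<subseteq> \<nn>_alg" and g: "g = foldr (\<lambda>X g. mexp X ** g) Xs (mat 1)"
    using N assms LieN unfolding connected_Lie_subgroup_def by blast
  show "g *v p - p \<in> \<W>"
    unfolding g using Xs \<nn>_raises(1)
    by (intro product_of_mexp_displacement[where T = UNIV] subspace_W) auto
  show "g *v p - p \<in> \<V>" if "p \<in> \<W>"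
    unfolding g using Xs \<nn>_raises(2) that
    by (intro product_of_mexp_displacement[where T = \<W>] subspace_W subspace_V)
      (auto simp: \<W>_def \<V>_def)
qed

lemma mexp_in_N: "X \<in> \<nn>_alg \<Longrightarrow> mexp X \<in> N"
  using LieN unfolding Lie_algebra_def by (metis (mono_tags, lifting) mem_Collect_eq scaleR_one)

text \<open>
  The equation \<open>x\<^sub>2 - x\<^sub>4 = p\<^sub>2 - p\<^sub>4\<close> is preserved, and null rotations about \<open>u\<^sub>b\<close> are transitive on its
  solutions because \<open>ip u\<^sub>b p = p\<^sub>4 - p\<^sub>2\<close> does not vanish.
\<close>

lemma orbit_generic:
  assumes p: "p \<in> AdS" "p $ Inl 2 \<noteq> p $ Inl 4"
  shows "orbit N p = AdS \<inter> (\<lambda>x. p + x) ` \<W>"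
  using p by (intro orbit_eq_slice[where u = u\<^sub>b] N_group N_SO N_displacement subspace_W mexp_in_N biv_u\<^sub>b_in_\<nn>)
    (auto simp: ip_weight_vectors weight_vector_coordinates \<W>_def)

text \<open>
  Now \<open>u\<^sub>b\<close> is orthogonal to \<open>p\<close> and its null rotations can only move \<open>p\<close> along \<open>u\<^sub>b\<close>. Instead \<open>u\<^sub>a\<close> is used,
  whose product with \<open>p\<close> cannot vanish as well.
\<close>

lemma orbit_special:
  assumes p: "p \<in> AdS" "p $ Inl 2 = p $ Inl 4"
  shows "orbit N p = AdS \<inter> (\<lambda>x. p + x) ` \<V>"
  using p AdS_degenerate[OF p]
  by (intro orbit_eq_slice[where u = u\<^sub>a] N_group N_SO N_displacement subspace_V mexp_in_N biv_u\<^sub>a_in_\<nn>)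
    (auto simp: ip_weight_vectors weight_vector_coordinates \<W>_def \<V>_def)

end

lemma mfd_dim_generic_slice:
  fixes p :: "real^(4 + 'm::finite)"
  assumes p: "p \<in> AdS" "p $ Inl 2 \<noteq> p $ Inl 4"
  shows "mfd_dim (AdS \<inter> (\<lambda>x. p + x) ` \<W>) = CARD('m) + 2"
proof -
  have "mfd_dim (AdS \<inter> (\<lambda>x. p + x) ` \<W>) = dim (\<W> :: (real^(4 + 'm)) set) - 1"
    by (rule mfd_dim_AdS_slice[OF p(1) subspace_W], rule bexI[of _ u\<^sub>b])
      (use p(2) in \<open>auto simp: ip_weight_vectors weight_vector_coordinates \<W>_def\<close>)
  then show ?thesis by (simp add: dim_W)
qed

lemma mfd_dim_special_slice:
  fixes p :: "real^(4 + 'm::finite)"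
  assumes p: "p \<in> AdS" "p $ Inl 2 = p $ Inl 4"
  shows "mfd_dim (AdS \<inter> (\<lambda>x. p + x) ` \<V>) = CARD('m) + 1"
proof -
  have "mfd_dim (AdS \<inter> (\<lambda>x. p + x) ` \<V>) = dim (\<V> :: (real^(4 + 'm)) set) - 1"
    by (rule mfd_dim_AdS_slice[OF p(1) subspace_V], rule bexI[of _ u\<^sub>a])
      (use AdS_degenerate[OF p] in \<open>auto simp: ip_weight_vectors weight_vector_coordinates \<V>_def\<close>)
  then show ?thesis by (simp add: dim_V)
qed

lemma mfd_dim_AdS: "mfd_dim (AdS :: (real^(4 + 'm::finite)) set) = CARD('m) + 3"
proof -
  obtain p :: "real^(4 + 'm)" where p: "p \<in> AdS" using AdS_points(1)[OF one_neq_zero] by blast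
  have "mfd_dim (AdS \<inter> (\<lambda>x. p + x) ` UNIV) = dim (UNIV :: (real^(4 + 'm)) set) - 1"
  proof (rule mfd_dim_AdS_slice[OF p subspace_UNIV])
    fix x :: "real^(4 + 'm)" assume x: "x \<in> AdS"
    show "\<exists>u\<in>UNIV. ip u u = 0 \<and> ip x u \<noteq> 0"
      using AdS_degenerate[OF x] by (cases "x $ Inl 2 = x $ Inl 4")
       (auto intro: exI[of _ u\<^sub>a] exI[of _ u\<^sub>b] simp: ip_weight_vectors weight_vector_coordinates)
  qed
  then show ?thesis by (simp add: surj_plus)
qed

theorem proposition4p1:
  fixes n :: nat
    and N :: "(real^(4 + 'm::finite)^(4 + 'm)) set"
  assumes "n \<ge> 3" and "CARD('m) = n - 2"
    and "connected_Lie_subgroup N SO0_2n" and "Lie_algebra N = \<nn>_alg"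
  shows "acts_isometrically N AdS \<and> cohomogeneity N AdS = 1 \<and>
    (\<forall>p\<in>AdS. p $ Inl 2 \<noteq> p $ Inl 4 \<longrightarrow>
       principal_orbit N AdS (orbit N p) \<and>
       orbit N p = AdS \<inter> (\<lambda>x. p + x) ` \<W>) \<and>
    (\<forall>p\<in>AdS. p $ Inl 2 = p $ Inl 4 \<longrightarrow>
       singular_orbit N AdS (orbit N p) \<and>
       mfd_dim (orbit N p) = n - 1 \<and>
       orbit N p = AdS \<inter> (\<lambda>x. p + x) ` \<V>) \<and>
    (\<exists>F. bij_betw F {B. principal_orbit N AdS B} (UNIV - {0::real}) \<and>
       (\<forall>B. principal_orbit N AdS B \<longrightarrow> (\<forall>p\<in>B. F B = p $ Inl 2 - p $ Inl 4))) \<and>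
    (\<exists>F. bij_betw F {B. singular_orbit N AdS B} (UNIV - {0::real}) \<and>
       (\<forall>B. singular_orbit N AdS B \<longrightarrow> (\<forall>p\<in>B. F B = p $ Inl 1 - p $ Inl 3)))"
proof -
  note N = assms(3,4)
  let ?M = "AdS :: (real^(4 + 'm)) set"
  let ?gen = "{p \<in> ?M. p $ Inl 2 \<noteq> p $ Inl 4}" and ?spec = "{p \<in> ?M. p $ Inl 2 = p $ Inl 4}"
  have split: "?M = ?gen \<union> ?spec" by auto
  have dim_gen: "mfd_dim (orbit N p) = n" if "p \<in> ?gen" for p
    using that mfd_dim_generic_slice[of p] orbit_generic[OF N, of p] assms(1,2) by simp
  have dim_spec: "mfd_dim (orbit N p) = n - 1" if "p \<in> ?spec" for p
    using that mfd_dim_special_slice[of p] orbit_special[OF N, of p] assms(1,2) by simp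
  have ne: "?gen \<noteq> {}" "?spec \<noteq> {}"
    using AdS_points[where 'm = 'm, OF one_neq_zero] by force+
  have principal: "principal_orbit N ?M B \<longleftrightarrow> B \<in> orbit N ` ?gen" for B
  proof
    assume B: "principal_orbit N ?M B"
    obtain q where "q \<in> ?gen" using ne by blast
    then have "n \<le> mfd_dim B"
      using B dim_gen[of q] by (auto simp: principal_orbit_def orbits_def)
    then show "B \<in> orbit N ` ?gen"
      using B dim_spec assms(1) by (fastforce simp: principal_orbit_def orbits_def)
  next
    assume B: "B \<in> orbit N ` ?gen"
    have "mfd_dim B' \<le> n" if "B' \<in> orbits N ?M" for B'
      using that dim_gen dim_spec unfolding orbits_def by (subst (asm) split) auto
    then show "principal_orbit N ?M B"
      using B dim_gen by (auto simp: principal_orbit_def orbits_def)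
  qed
  have singular: "singular_orbit N ?M B \<longleftrightarrow> B \<in> orbit N ` ?spec" for B
  proof
    assume B: "singular_orbit N ?M B"
    then obtain B' where "B' \<in> orbits N ?M" "mfd_dim B < mfd_dim B'" by (auto simp: singular_orbit_def)
    then have "mfd_dim B \<noteq> n"
      using dim_gen dim_spec unfolding orbits_def by (subst (asm) split) auto
    then show "B \<in> orbit N ` ?spec"
      using B dim_gen by (fastforce simp: singular_orbit_def orbits_def)
  next
    assume B: "B \<in> orbit N ` ?spec"
    then have "mfd_dim B = n - 1" using dim_spec by auto
    moreover obtain q where "q \<in> ?gen" using ne by blast
    ultimately show "singular_orbit N ?M B"
      using B dim_gen[of q] assms(1) unfolding singular_orbit_def orbits_def by force
  qed
  have "codim_in ?M ` orbits N ?M = {1, 2}"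
  proof -
    have "codim_in ?M ` orbits N ?M = (\<lambda>p. codim_in ?M (orbit N p)) ` ?gen \<union> (\<lambda>p. codim_in ?M (orbit N p)) ` ?spec"
      unfolding orbits_def by (subst (2) split) (simp only: image_Un image_image)
    also have "(\<lambda>p. codim_in ?M (orbit N p)) ` ?gen = (\<lambda>p. 1) ` ?gen"
      by (rule image_cong[OF refl]) (use assms(1,2) in \<open>simp add: codim_in_def mfd_dim_AdS dim_gen\<close>)
    also have "(\<lambda>p. codim_in ?M (orbit N p)) ` ?spec = (\<lambda>p. 2) ` ?spec"
      by (rule image_cong[OF refl]) (use assms(1,2) in \<open>simp add: codim_in_def mfd_dim_AdS dim_spec\<close>)
    finally show ?thesis using ne by auto
  qed
  then have cohom: "cohomogeneity N ?M = 1"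
    by (simp add: cohomogeneity_def)
  have isom: "acts_isometrically N ?M"
    using N_group[OF N] N_SO[OF N] by (auto simp: acts_isometrically_def SO_2n_def AdS_def)
  \<comment> \<open>An invariant that separates the orbits inside \<open>P\<close> descends to a bijection from the set of orbits onto its range.\<close>
  have par: "\<exists>F. bij_betw F (orbit N ` P) (UNIV - {0::real}) \<and> (\<forall>B\<in>orbit N ` P. \<forall>p\<in>B. F B = \<phi> p)"
    if orb: "\<And>p x. p \<in> P \<Longrightarrow> x \<in> orbit N p \<longleftrightarrow> x \<in> P \<and> \<phi> x = \<phi> p"
      and range: "\<phi> ` P = UNIV - {0}" for P :: "(real^(4 + 'm)) set" and \<phi> :: "_ \<Rightarrow> real"
  proof -
    define F where "F B = \<phi> (SOME x. x \<in> B)" for B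
    have F: "F B = \<phi> q" if "B \<in> orbit N ` P" "q \<in> B" for B q
    proof -
      have "(SOME x. x \<in> B) \<in> B" using that(2) by (rule someI)
      then show ?thesis using that orb unfolding F_def by auto
    qed
    have Fp: "F (orbit N p) = \<phi> p" if "p \<in> P" for p
      using F[of "orbit N p" p] orb[OF that, of p] that by blast
    have "inj_on F (orbit N ` P)"
    proof (rule inj_onI; clarify)
      fix p q assume "p \<in> P" "q \<in> P" "F (orbit N p) = F (orbit N q)"
      then show "orbit N p = orbit N q" using orb Fp by auto
    qed
    moreover have "F ` orbit N ` P = UNIV - {0}"
      using range Fp by (auto simp: image_image)
    ultimately show ?thesis using F by (auto simp: bij_betw_def)
  qed
  have par_gen: "\<exists>F. bij_betw F (orbit N ` ?gen) (UNIV - {0::real}) \<and>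
      (\<forall>B\<in>orbit N ` ?gen. \<forall>p\<in>B. F B = p $ Inl 2 - p $ Inl 4)"
  proof (rule par)
    show "x \<in> orbit N p \<longleftrightarrow> x \<in> ?gen \<and> x $ Inl 2 - x $ Inl 4 = p $ Inl 2 - p $ Inl 4"
      if p: "p \<in> ?gen" for p x
    proof -
      have "x \<in> orbit N p \<longleftrightarrow> x \<in> ?M \<and> x - p \<in> \<W>"
        using p orbit_generic[OF N, of p] mem_AdS_slice[of x p \<W>] by simp
      then show ?thesis using p by (auto simp: \<W>_def algebra_simps)
    qed
    show "(\<lambda>x. x $ Inl 2 - x $ Inl 4) ` ?gen = UNIV - {0}"
      using AdS_points(1)[where 'm = 'm] by (force simp: image_iff)
  qed
  have par_spec: "\<exists>F. bij_betw F (orbit N ` ?spec) (UNIV - {0::real}) \<and>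
      (\<forall>B\<in>orbit N ` ?spec. \<forall>p\<in>B. F B = p $ Inl 1 - p $ Inl 3)"
  proof (rule par)
    show "x \<in> orbit N p \<longleftrightarrow> x \<in> ?spec \<and> x $ Inl 1 - x $ Inl 3 = p $ Inl 1 - p $ Inl 3"
      if p: "p \<in> ?spec" for p x
    proof -
      have "x \<in> orbit N p \<longleftrightarrow> x \<in> ?M \<and> x - p \<in> \<V>"
        using p orbit_special[OF N, of p] mem_AdS_slice[of x p \<V>] by simp
      then show ?thesis using p by (auto simp: \<V>_def algebra_simps)
    qed
    show "(\<lambda>x. x $ Inl 1 - x $ Inl 3) ` ?spec = UNIV - {0}"
      using AdS_points(2)[where 'm = 'm] AdS_degenerate by (force simp: image_iff)
  qed
  show ?thesis
  proof (intro conjI ballI impI)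
    show "acts_isometrically N ?M" "cohomogeneity N ?M = 1" by (fact isom cohom)+
    show "principal_orbit N ?M (orbit N p)" "orbit N p = ?M \<inter> (\<lambda>x. p + x) ` \<W>"
      if "p \<in> ?M" "p $ Inl 2 \<noteq> p $ Inl 4" for p
      using that orbit_generic[OF N] by (auto simp: principal)
    show "singular_orbit N ?M (orbit N p)" "mfd_dim (orbit N p) = n - 1"
      "orbit N p = ?M \<inter> (\<lambda>x. p + x) ` \<V>"
      if "p \<in> ?M" "p $ Inl 2 = p $ Inl 4" for p
      using that orbit_special[OF N] dim_spec by (auto simp: singular)
  qed (use par_gen par_spec in \<open>unfold principal singular Collect_mem_eq Ball_def\<close>)
qed

end
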